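(* Let $P=\{p_1,\ldots,p_n\}\subset\mathbb{R}^d$ and let $x\in\mathbb{R}^d$ be a point such that every simplex in $\mathrm{cov}_P(x)$ is $d$-dimensional. Let $M$ be a closed PL manifold of dimension $d$ and let $T$ be a triangulation of $M$. Then for every labelling $L:V(T)\to\{1,2,\ldots,n\}$, the number of $d$-simplices of $T$ whose vertices carry $d+1$ distinct labels $i_0,\ldots,i_d$ such that the simplex $\mathrm{conv}(p_{i_0},\ldots,p_{i_d})$ belongs to $\mathrm{cov}_P(x)$ is even.
   Context: For a finite set $P=\{p_1,\ldots,p_n\}\subset\mathbb{R}^d$, let $S(P)$ be the collection of all simplices $\mathrm{conv}(p_{i_1},\ldots,p_{i_k})$ spanned by $k$ points of $P$ with $1\le k\le d+1$; for $x\in\mathbb{R}^d$, $\mathrm{cov}_P(x)$ denotes the set of simplices in $S(P)$ that contain $x$ (possibly empty). $V(T)$ denotes the vertex set of the triangulation $T$. A closed manifold is a compact manifold without boundary; a PL manifold is one equipped with a piecewise linear structure (in particular it admits a triangulation). *)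

theory Defs
  imports "HOL-Analysis.Analysis"
begin

text \<open>
  Throughout, the dimension \<open>d\<close> is \<open>CARD('d)\<close>, so \<open>d \<ge> 1\<close>.
\<close>

text \<open>
  The simplices spanned by at most \<open>d + 1\<close> points of \<open>P\<close>, as point sets. The points are not
  required to be affinely independent, so a simplex may be degenerate.
\<close>

definition spanned_simplices :: "(real^'d) set \<Rightarrow> (real^'d) set set" where
  "spanned_simplices P =
     {convex hull F | F. F \<subseteq> P \<and> 1 \<le> card F \<and> card F \<le> CARD('d) + 1}"

definition cov :: "(real^'d) set \<Rightarrow> real^'d \<Rightarrow> (real^'d) set set" where
  "cov P x = {S \<in> spanned_simplices P. x \<in> S}"

text \<open>
  A map on a set \<open>U\<close> (in practice an open set) is piecewise linear if every point of \<open>U\<close> has a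
  neighbourhood that is a finite union of polytopes on each of which the map is affine. Continuity
  follows, since the polytopes are closed.
\<close>

definition PL_on :: "(real^'d) set \<Rightarrow> (real^'d \<Rightarrow> real^'d) \<Rightarrow> bool" where
  "PL_on U f \<longleftrightarrow>
     (\<forall>x\<in>U. \<exists>\<K>. finite \<K> \<and> x \<in> interior (\<Union>\<K>) \<and>
        (\<forall>K\<in>\<K>. polytope K \<and> K \<subseteq> U \<and>
           (\<exists>A b. linear A \<and> (\<forall>y\<in>K. f y = A y + b))))"

text \<open>
  A chart is a pair \<open>(U, \<phi>)\<close>; the values of \<open>\<phi>\<close> outside \<open>U\<close> are irrelevant. Since images of charts
  are open in the whole of \<open>real^'d\<close>, there are no boundary points. The PL structure is given by
  any atlas with PL coordinate changes (which determines a unique maximal one).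
\<close>

definition is_chart :: "'m topology \<Rightarrow> 'm set \<Rightarrow> ('m \<Rightarrow> real^'d) \<Rightarrow> bool" where
  "is_chart M U \<phi> \<longleftrightarrow>
     openin M U \<and> open (\<phi> ` U) \<and>
     homeomorphic_map (subtopology M U) (top_of_set (\<phi> ` U)) \<phi>"

definition PL_atlas :: "'m topology \<Rightarrow> ('m set \<times> ('m \<Rightarrow> real^'d)) set \<Rightarrow> bool" where
  "PL_atlas M \<A> \<longleftrightarrow>
     (\<forall>(U, \<phi>) \<in> \<A>. is_chart M U \<phi>) \<and>
     (\<Union>(U, \<phi>) \<in> \<A>. U) = topspace M \<and>
     (\<forall>(U, \<phi>) \<in> \<A>. \<forall>(V, \<psi>) \<in> \<A>. PL_on (\<phi> ` (U \<inter> V)) (\<psi> \<circ> inv_into U \<phi>))"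

text \<open>
  Second countability need not be required separately: it follows from compactness and the
  existence of an atlas. Connectedness is not required.
\<close>

definition closed_PL_manifold :: "'m topology \<Rightarrow> ('m set \<times> ('m \<Rightarrow> real^'d)) set \<Rightarrow> bool" where
  "closed_PL_manifold M \<A> \<longleftrightarrow> compact_space M \<and> Hausdorff_space M \<and> PL_atlas M \<A>"

text \<open>
  A finite geometric simplicial complex in some Euclidean space whose underlying polyhedron is
  homeomorphic to \<open>M\<close>. As \<open>M\<close> will be compact, finiteness is no restriction. The homeomorphism is
  not required to be PL with respect to an atlas of \<open>M\<close>.
\<close>

definition triangulates :: "'v::euclidean_space set set \<Rightarrow> 'm topology \<Rightarrow> bool" where
  "triangulates T M \<longleftrightarrow> simplicial_complex T \<and> top_of_set (\<Union>T) homeomorphic_space M"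

definition vertex_set :: "'v::euclidean_space set set \<Rightarrow> 'v set" where
  "vertex_set T = {v. {v} \<in> T}"

definition vertices :: "'v::euclidean_space set \<Rightarrow> 'v set" where
  "vertices \<sigma> = {v. v extreme_point_of \<sigma>}"

end

theory Submission
  imports Defs
begin

text \<open>
  Let \<open>C\<close> be the set of \<open>d + 1\<close> vertices of a \<open>d\<close>-simplex of \<open>T\<close>, and choose a point \<open>y\<close> such that
  \<open>x\<close> lies in no simplex spanned by \<open>y\<close> and at most \<open>d - 1\<close> of the points \<open>p i\<close>. Then \<open>x\<close> lies in an
  even number of the \<open>d\<close>-simplices spanned by \<open>d + 1\<close> of the \<open>d + 2\<close> points \<open>y\<close> and \<open>p (L v)\<close>,
  \<open>v \<in> C\<close> (counted with multiplicity). So, modulo 2, the simplex is counted if and only if \<open>x\<close> lies in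
  the cone with apex \<open>y\<close> over the image of an odd number of its facets. Summing over \<open>T\<close>, every facet
  contributes twice, because a \<open>(d - 1)\<close>-simplex of \<open>T\<close> is a face of exactly two \<open>d\<close>-simplices. The
  latter holds for every triangulation of a topological manifold, by invariance of domain.
\<close>

section \<open>Simplices spanned by \<open>d + 2\<close> points\<close>

text \<open>Weights are attached to indices rather than to points, so that families with coinciding
  points need no separate treatment.\<close>

lemma in_convex_hull_image_iff:
  fixes q :: "'i \<Rightarrow> 'a::real_vector"
  assumes "finite J"
  shows "x \<in> convex hull (q ` J) \<longleftrightarrow>
    (\<exists>u. (\<forall>i\<in>J. 0 \<le> u i) \<and> sum u J = 1 \<and> (\<Sum>i\<in>J. u i *\<^sub>R q i) = x)"
proof
  let ?R = "{x. \<exists>u. (\<forall>i\<in>J. 0 \<le> u i) \<and> sum u J = 1 \<and> (\<Sum>i\<in>J. u i *\<^sub>R q i) = x}"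
  assume "x \<in> convex hull (q ` J)"
  moreover have "convex hull (q ` J) \<subseteq> ?R"
  proof (rule hull_minimal)
    show "q ` J \<subseteq> ?R"
    proof clarsimp
      fix j assume "j \<in> J"
      then show "\<exists>u. (\<forall>i\<in>J. 0 \<le> u i) \<and> sum u J = 1 \<and> (\<Sum>i\<in>J. u i *\<^sub>R q i) = q j"
        using assms
        by (intro exI[of _ "\<lambda>i. if i = j then 1 else 0"]) (auto simp: if_distrib[of "\<lambda>c. c *\<^sub>R _"] cong: if_cong)
    qed
    show "convex ?R"
    proof (rule convexI, clarsimp)
      fix u v :: "'i \<Rightarrow> real" and s t :: real
      assume "0 \<le> s" "0 \<le> t" "s + t = 1" "\<forall>i\<in>J. 0 \<le> u i" "\<forall>i\<in>J. 0 \<le> v i" "sum u J = 1" "sum v J = 1"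
      then show "\<exists>w. (\<forall>i\<in>J. 0 \<le> w i) \<and> sum w J = 1 \<and>
          (\<Sum>i\<in>J. w i *\<^sub>R q i) = s *\<^sub>R (\<Sum>i\<in>J. u i *\<^sub>R q i) + t *\<^sub>R (\<Sum>i\<in>J. v i *\<^sub>R q i)"
        by (intro exI[of _ "\<lambda>i. s * u i + t * v i"])
          (auto simp: sum.distrib scaleR_add_left scaleR_sum_right simp flip: sum_distrib_left)
    qed
  qed
  ultimately show "\<exists>u. (\<forall>i\<in>J. 0 \<le> u i) \<and> sum u J = 1 \<and> (\<Sum>i\<in>J. u i *\<^sub>R q i) = x" by blast
next
  assume "\<exists>u. (\<forall>i\<in>J. 0 \<le> u i) \<and> sum u J = 1 \<and> (\<Sum>i\<in>J. u i *\<^sub>R q i) = x"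
  then obtain u where u: "\<forall>i\<in>J. 0 \<le> u i" "sum u J = 1" "(\<Sum>i\<in>J. u i *\<^sub>R q i) = x" by blast
  have "(\<Sum>i\<in>J. u i *\<^sub>R q i) \<in> convex hull (q ` J)"
    using u by (intro convex_sum assms convex_convex_hull) (auto intro: hull_inc)
  then show "x \<in> convex hull (q ` J)" using u(3) by simp
qed

text \<open>If \<open>q\<close> is injective, there are too many distinct points to be affinely
  independent; otherwise two coinciding points give a relation with weights 1 and -1.\<close>

lemma affine_dependency_image:
  fixes q :: "'i \<Rightarrow> 'a::euclidean_space"
  assumes "finite I" and "card I = DIM('a) + 2"
  obtains w where "\<exists>i\<in>I. w i \<noteq> (0::real)" "sum w I = 0" "(\<Sum>i\<in>I. w i *\<^sub>R q i) = 0"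
proof (cases "inj_on q I")
  case True
  then have "affine_dependent (q ` I)"
    using assms by (intro affine_dependent_biggerset) (auto simp: card_image)
  then obtain U where U: "sum U (q ` I) = 0" "\<exists>v\<in>q ` I. U v \<noteq> 0" "(\<Sum>v\<in>q ` I. U v *\<^sub>R v) = 0"
    using assms by (auto simp: affine_dependent_explicit_finite)
  show ?thesis
    by (rule that[of "U \<circ> q"]) (use U True in \<open>auto simp: sum.reindex\<close>)
next
  case False
  then obtain i j where ij: "i \<in> I" "j \<in> I" "i \<noteq> j" "q i = q j" by (auto simp: inj_on_def)
  define w where "w = (\<lambda>k. if k = i then 1 else if k = j then -1 else (0::real))"
  have w: "w = (\<lambda>k. (if k = i then 1 else 0) - (if k = j then 1 else 0))"
    using ij by (auto simp: w_def)
  have *: "(\<Sum>k\<in>I. (if k = l then 1 else (0::real)) *\<^sub>R q k) = q l" if "l \<in> I" for l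
    using assms that by (simp add: if_distrib[of "\<lambda>c. c *\<^sub>R _"] cong: if_cong)
  show ?thesis
  proof
    show "\<exists>k\<in>I. w k \<noteq> 0" using ij by (auto simp: w_def)
    show "sum w I = 0" using ij assms by (simp add: w sum_subtractf)
    show "(\<Sum>k\<in>I. w k *\<^sub>R q k) = 0"
      using * ij by (simp add: w scaleR_diff_left sum_subtractf)
  qed
qed

text \<open>
  The representations of \<open>x\<close> as a convex combination of the \<open>q i\<close> form a polytope. General position
  makes every point of it have at most one vanishing coordinate, so the polytope is empty or a
  segment, and the simplices in question correspond to its endpoints.
\<close>

lemma even_card_simplices_containing:
  fixes q :: "'i \<Rightarrow> 'a::euclidean_space"
  assumes fin: "finite I" and card: "card I = DIM('a) + 2"
    and gen: "\<And>J. J \<subseteq> I \<Longrightarrow> card J \<le> DIM('a) \<Longrightarrow> x \<notin> convex hull (q ` J)"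
  shows "even (card {i \<in> I. x \<in> convex hull (q ` (I - {i}))})"
proof -
  \<comment> \<open>\<open>sol\<close> describes the polytope of weights representing
    \<open>x\<close>, and \<open>ker\<close> the directions along which its defining equations
    persist.\<close>
  define sol where "sol u \<longleftrightarrow> (\<forall>i\<in>I. 0 \<le> u i) \<and> sum u I = 1 \<and> (\<Sum>i\<in>I. u i *\<^sub>R q i) = x" for u
  define ker where "ker w \<longleftrightarrow> sum w I = 0 \<and> (\<Sum>i\<in>I. w i *\<^sub>R q i) = 0" for w
  have hull: "x \<in> convex hull (q ` J) \<longleftrightarrow> (\<exists>u. sol u \<and> (\<forall>i\<in>I - J. u i = 0))" if J: "J \<subseteq> I" for J
  proof -
    have finJ: "finite J" using J fin finite_subset by blast
    show ?thesis
    proof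
      assume "x \<in> convex hull (q ` J)"
      then obtain u where u: "\<forall>i\<in>J. 0 \<le> u i" "sum u J = 1" "(\<Sum>i\<in>J. u i *\<^sub>R q i) = x"
        using in_convex_hull_image_iff[OF finJ] by blast
      define v where "v i = (if i \<in> J then u i else 0)" for i
      have "sum v I = sum u J" "(\<Sum>i\<in>I. v i *\<^sub>R q i) = (\<Sum>i\<in>J. u i *\<^sub>R q i)"
        by (rule sum.mono_neutral_cong_right; use J fin in \<open>auto simp: v_def\<close>)+
      then have "sol v" using u by (auto simp: sol_def v_def)
      then show "\<exists>u. sol u \<and> (\<forall>i\<in>I - J. u i = 0)" by (auto simp: v_def)
    next
      assume "\<exists>u. sol u \<and> (\<forall>i\<in>I - J. u i = 0)"
      then obtain u where u: "sol u" "\<forall>i\<in>I - J. u i = 0" by blast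
      have "sum u J = sum u I" "(\<Sum>i\<in>J. u i *\<^sub>R q i) = (\<Sum>i\<in>I. u i *\<^sub>R q i)"
        by (rule sum.mono_neutral_left; use J fin u in auto)+
      then show "x \<in> convex hull (q ` J)"
        unfolding in_convex_hull_image_iff[OF finJ] using u(1) J
        by (intro exI[of _ u]) (auto simp: sol_def)
    qed
  qed
  \<comment> \<open>Two zero weights would put \<open>x\<close> into the hull of only
    \<open>DIM('a)\<close> points, against \<open>gen\<close>.\<close>
  have one_zero: "i = j" if "sol u" "i \<in> I" "j \<in> I" "u i = 0" "u j = 0" for u i j
  proof (rule ccontr)
    assume "i \<noteq> j"
    then have "card (I - {i, j}) \<le> DIM('a)" using that card fin by (simp add: card_Diff_subset)
    moreover have "x \<in> convex hull (q ` (I - {i, j}))"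
      by (subst hull) (use that in auto)
    ultimately show False using gen[of "I - {i, j}"] by blast
  qed
  \<comment> \<open>The ratio test of the simplex method: move from \<open>u\<close> along
    \<open>w\<close> until a weight first reaches 0. Only weights with \<open>w j < 0\<close>
    decrease, so the step length is the minimum of \<open>u j / - w j\<close> over these
    \<open>j\<close>.\<close>
  have pivot: "\<exists>j\<in>I. w j < 0 \<and> (\<exists>s. sol (\<lambda>k. u k + s * w k) \<and> u j + s * w j = 0)"
    if u: "sol u" and w: "ker w" and neg: "\<exists>j\<in>I. w j < 0" for u w
  proof -
    define N where "N = {j \<in> I. w j < 0}"
    define s where "s = Min ((\<lambda>j. u j / - w j) ` N)"
    have N: "finite N" "N \<noteq> {}" using fin neg by (auto simp: N_def)
    then have "s \<in> (\<lambda>j. u j / - w j) ` N" by (auto simp: s_def intro!: Min_in)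
    then obtain j where j: "j \<in> N" "s = u j / - w j" by blast
    have le: "s \<le> u k / - w k" if "k \<in> N" for k
      using that N by (auto simp: s_def intro!: Min_le)
    have s0: "0 \<le> s" using j u by (auto simp: N_def sol_def intro!: divide_nonneg_nonneg simp del: divide_minus_right)
    have "0 \<le> u k + s * w k" if "k \<in> I" for k
    proof (cases "w k < 0")
      case True
      then have "s * - w k \<le> u k" using le[of k] that by (simp add: N_def pos_le_divide_eq del: divide_minus_right)
      then show ?thesis by simp
    next
      case False
      then show ?thesis using s0 u that by (simp add: sol_def)
    qed
    moreover have "(\<Sum>k\<in>I. u k + s * w k) = 1"
      using u w by (simp add: sol_def ker_def sum.distrib flip: sum_distrib_left)
    moreover have "(\<Sum>k\<in>I. (u k + s * w k) *\<^sub>R q k) = x"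
    proof -
      have "(\<Sum>k\<in>I. (u k + s * w k) *\<^sub>R q k) = (\<Sum>k\<in>I. u k *\<^sub>R q k) + s *\<^sub>R (\<Sum>k\<in>I. w k *\<^sub>R q k)"
        by (simp add: scaleR_add_left sum.distrib scaleR_sum_right)
      then show ?thesis using u w by (simp add: sol_def ker_def)
    qed
    ultimately have "sol (\<lambda>k. u k + s * w k)" by (simp add: sol_def)
    moreover have "u j + s * w j = 0" using j by (simp add: N_def)
    ultimately show ?thesis using j(1) unfolding N_def by blast
  qed
  have negex: "\<exists>j\<in>I. w j < 0" if "ker w" "\<exists>i\<in>I. w i \<noteq> 0" for w
  proof (rule ccontr)
    assume "\<not> (\<exists>j\<in>I. w j < 0)"
    then have "\<forall>i\<in>I. w i = 0"
      using that(1) fin by (subst sum_nonneg_eq_0_iff[symmetric]) (auto simp: ker_def not_less)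
    then show False using that by blast
  qed
  \<comment> \<open>A nonzero \<open>w\<close> would have a negative entry, and pivoting from
    \<open>u\<close> would create a zero at some \<open>j \<noteq> i\<close> while keeping the one
    at \<open>i\<close>. By linearity \<open>ker\<close> is thus at most one-dimensional on
    \<open>I\<close> once such a \<open>u\<close> exists.\<close>
  have kernel0: "\<forall>k\<in>I. w k = 0" if sk: "sol u" "ker w" and "i \<in> I" "u i = 0" "w i = 0" for u w i
  proof (rule ccontr)
    assume "\<not> (\<forall>k\<in>I. w k = 0)"
    then have "\<exists>j\<in>I. w j < 0" using negex[OF sk(2)] by blast
    then obtain j s where "j \<in> I" "w j < 0" "sol (\<lambda>k. u k + s * w k)" "u j + s * w j = 0"
      using pivot[OF sk] by blast
    then show False using one_zero[of "\<lambda>k. u k + s * w k" i j] that by auto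
  qed
  define A where "A = {i \<in> I. x \<in> convex hull (q ` (I - {i}))}"
  have A: "i \<in> A \<longleftrightarrow> i \<in> I \<and> (\<exists>u. sol u \<and> u i = 0)" for i
    by (auto simp: A_def hull)
  have finA: "finite A" using fin by (simp add: A_def)
  \<comment> \<open>Leave the endpoint with zero at \<open>i\<close> in a direction with
    \<open>w i > 0\<close>; the pivot stops at a zero \<open>j\<close> with \<open>w j < 0\<close>,
    so \<open>j \<noteq> i\<close>.\<close>
  have other: "\<exists>j\<in>A. j \<noteq> i" if i: "i \<in> A" for i
  proof -
    obtain u where u: "i \<in> I" "sol u" "u i = 0" using i unfolding A by blast
    obtain w0 where w0: "\<exists>i\<in>I. w0 i \<noteq> 0" "ker w0"
      using affine_dependency_image[OF fin card, of q] unfolding ker_def by blast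
    then have "w0 i \<noteq> 0" using kernel0[OF u(2) w0(2) u(1,3)] by blast
    have "ker (\<lambda>k. - w0 k)" using w0 by (simp add: ker_def sum_negf)
    have "\<exists>w. ker w \<and> w i > 0"
    proof (cases "w0 i > 0")
      case True
      then show ?thesis using w0(2) by blast
    next
      case False
      then have "- w0 i > 0" using \<open>w0 i \<noteq> 0\<close> by simp
      then show ?thesis using \<open>ker (\<lambda>k. - w0 k)\<close> by blast
    qed
    then obtain w where w: "ker w" "w i > 0" by blast
    then have "\<exists>j\<in>I. w j \<noteq> 0" using u(1) by (intro bexI[of _ i]) auto
    then have "\<exists>j\<in>I. w j < 0" by (rule negex[OF w(1)])
    then obtain j s where "j \<in> I" "w j < 0" "sol (\<lambda>k. u k + s * w k)" "u j + s * w j = 0"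
      using pivot[OF u(2) w(1)] by blast
    then show ?thesis using w unfolding A by (intro bexI[of _ j]) (auto simp: A)
  qed
  have no_third: False if ijk: "i \<in> A" "j \<in> A" "k \<in> A" "i \<noteq> j" "i \<noteq> k" "j \<noteq> k" for i j k
  proof -
    obtain a b c where abc: "i \<in> I" "j \<in> I" "k \<in> I" "sol a" "a i = 0" "sol b" "b j = 0" "sol c" "c k = 0"
      using ijk unfolding A by blast
    have pos: "v m > 0" if "sol v" "m \<in> I" "l \<in> I" "v l = 0" "l \<noteq> m" for v l m
      using one_zero[of v l m] that by (force simp: sol_def)
    \<comment> \<open>This combination of \<open>c - a\<close> and \<open>b - a\<close> is chosen to
      vanish at \<open>i\<close>, where \<open>a\<close> vanishes too, so it is 0 on
      \<open>I\<close> by \<open>kernel0\<close>. Its entries at \<open>j\<close> and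
      \<open>k\<close> then force \<open>b i - c i\<close> to be both positive and negative: one of
      three points on a line would have to lie between the others.\<close>
    define w where "w m = b i * (c m - a m) - c i * (b m - a m)" for m
    have "(\<Sum>m\<in>I. w m *\<^sub>R q m) =
        b i *\<^sub>R ((\<Sum>m\<in>I. c m *\<^sub>R q m) - (\<Sum>m\<in>I. a m *\<^sub>R q m))
        - c i *\<^sub>R ((\<Sum>m\<in>I. b m *\<^sub>R q m) - (\<Sum>m\<in>I. a m *\<^sub>R q m))"
      by (simp add: w_def scaleR_diff_left scaleR_right_diff_distrib right_diff_distrib sum_subtractf scaleR_sum_right)
    moreover have "sum w I = b i * (sum c I - sum a I) - c i * (sum b I - sum a I)"
      by (simp add: w_def sum_subtractf flip: sum_distrib_left)
    ultimately have "ker w" using abc by (simp add: ker_def sol_def)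
    moreover have "w i = 0" using abc by (simp add: w_def)
    ultimately have "\<forall>m\<in>I. w m = 0" using kernel0[OF abc(4) _ abc(1,5)] by blast
    then have "w j = 0" "w k = 0" using abc by auto
    then have *: "b i * c j = (b i - c i) * a j" "c i * b k = (c i - b i) * a k"
      using abc by (auto simp: w_def algebra_simps)
    have "0 < b i" "0 < b k" "0 < c i" "0 < c j" "0 < a j" "0 < a k"
      using abc ijk pos[of b i j] pos[of b k j] pos[of c i k] pos[of c j k] pos[of a j i] pos[of a k i]
      by auto
    then have "0 < b i * c j" "0 < c i * b k" "0 < a j" "0 < a k" by auto
    then have "b i - c i > 0" "c i - b i > 0"
      unfolding * by (auto simp: zero_less_mult_iff)
    then show False by simp
  qed
  have "card A = 2" if ne: "A \<noteq> {}"
  proof -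
    obtain i where i: "i \<in> A" using ne by blast
    obtain j where ij: "j \<in> A" "j \<noteq> i" using other[OF i] by blast
    have "k = i \<or> k = j" if "k \<in> A" for k
      using no_third[OF i ij(1) that] ij(2) by metis
    then have "A = {i, j}" using i ij(1) by blast
    then show ?thesis using ij(2) by simp
  qed
  then show ?thesis unfolding A_def[symmetric] by (cases "A = {}") auto
qed

text \<open>The previous parity applied to \<open>y\<close> together with the points over
  \<open>C\<close>: omitting \<open>y\<close> leaves the simplex over \<open>C\<close>, and omitting
  \<open>v\<close> leaves the cone from \<open>y\<close> over the facet opposite
  \<open>v\<close>.\<close>

lemma even_card_simplices_containing_cone:
  fixes r :: "'i \<Rightarrow> 'a::euclidean_space"
  assumes fin: "finite C" and card: "card C = DIM('a) + 1"
    and gen: "\<And>J. J \<subseteq> C \<Longrightarrow> card J \<le> DIM('a) \<Longrightarrow> x \<notin> convex hull (r ` J)"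
    and gen_y: "\<And>J. J \<subseteq> C \<Longrightarrow> card J < DIM('a) \<Longrightarrow> x \<notin> convex hull (insert y (r ` J))"
  shows "even (of_bool (x \<in> convex hull (r ` C)) +
           card {v \<in> C. x \<in> convex hull (insert y (r ` (C - {v})))})"
proof -
  \<comment> \<open>\<open>None\<close> indexes the apex \<open>y\<close>, keeping it apart from the
    points over \<open>C\<close> even where it coincides with one of them.\<close>
  define I where "I = insert None (Some ` C)"
  define q where "q = case_option y r"
  define A where "A = {i \<in> I. x \<in> convex hull (q ` (I - {i}))}"
  have qS: "q ` Some ` J = r ` J" for J by (simp add: q_def image_image)
  have "even (card A)"
    unfolding A_def
  proof (rule even_card_simplices_containing)
    show "finite I" "card I = DIM('a) + 2" using fin card by (simp_all add: I_def card_image)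
    show "x \<notin> convex hull (q ` J)" if J: "J \<subseteq> I" "card J \<le> DIM('a)" for J
    proof -
      define K where "K = {v. Some v \<in> J}"
      have K: "K \<subseteq> C" "finite K" using J fin by (auto simp: K_def I_def intro: finite_subset)
      show ?thesis
      proof (cases "None \<in> J")
        case True
        then have JK: "J = insert None (Some ` K)"
          using J by (auto simp: K_def I_def image_iff)
        then have "card K < DIM('a)" using J(2) K(2) by (simp add: card_image)
        moreover have "q ` J = insert y (r ` K)" by (simp add: JK qS) (simp add: q_def)
        ultimately show ?thesis using gen_y[OF K(1)] by simp
      next
        case False
        then have JK: "J = Some ` K" using J by (auto simp: K_def I_def image_iff)
        then have "card K \<le> DIM('a)" using J(2) by (simp add: card_image)
        then show ?thesis using gen[OF K(1)] by (simp add: JK qS)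
      qed
    qed
  qed
  also have "A = (if x \<in> convex hull (r ` C) then {None} else {}) \<union>
      Some ` {v \<in> C. x \<in> convex hull (insert y (r ` (C - {v})))}" (is "A = ?N \<union> Some ` ?V")
  proof -
    have "I - {None} = Some ` C" by (auto simp: I_def)
    moreover have "q ` (I - {Some v}) = insert y (r ` (C - {v}))" for v
    proof -
      have "I - {Some v} = insert None (Some ` (C - {v}))" by (auto simp: I_def)
      then show ?thesis by (simp add: qS) (simp add: q_def)
    qed
    ultimately show ?thesis by (auto simp: A_def I_def qS)
  qed
  also have "card \<dots> = of_bool (x \<in> convex hull (r ` C)) + card ?V"
    using fin by (subst card_Un_disjoint) (auto simp: card_image)
  finally show ?thesis .
qed

section \<open>Codimension one faces in triangulated manifolds\<close>

text \<open>The \<open>itself\<close> argument fixes the model space \<open>'e\<close>, which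
  otherwise occurs only in the types of bound variables.\<close>

definition locally_euclidean :: "'e::euclidean_space itself \<Rightarrow> 'v::topological_space set \<Rightarrow> bool" where
  "locally_euclidean _ X \<longleftrightarrow>
     (\<forall>z\<in>X. \<exists>N h. openin (top_of_set X) N \<and> z \<in> N \<and> open (h ` N) \<and>
        (\<exists>k :: 'e \<Rightarrow> 'v. homeomorphism N (h ` N) h k))"

text \<open>A chart \<phi> of \<open>M\<close> is pulled back along the homeomorphism
  \<open>f\<close>: its domain becomes the preimage \<open>N\<close>, and the chart becomes
  \<open>\<phi> \<circ> f\<close>.\<close>

lemma closed_PL_manifold_imp_locally_euclidean:
  fixes M :: "'m topology" and \<A> :: "('m set \<times> ('m \<Rightarrow> real^'d)) set"
    and X :: "'v::euclidean_space set"
  assumes man: "closed_PL_manifold M \<A>" and hom: "top_of_set X homeomorphic_space M"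
  shows "locally_euclidean TYPE(real^'d) X"
  unfolding locally_euclidean_def
proof
  fix z assume "z \<in> X"
  obtain f g where fg: "homeomorphic_maps (top_of_set X) M f g"
    using hom by (auto simp: homeomorphic_space_def)
  then have f: "homeomorphic_map (top_of_set X) M f"
    using homeomorphic_map_maps by blast
  then have fz: "f z \<in> topspace M"
    using \<open>z \<in> X\<close> homeomorphic_imp_surjective_map by fastforce
  have at: "PL_atlas M \<A>" using man by (simp add: closed_PL_manifold_def)
  then have "(\<Union>(U, \<phi>)\<in>\<A>. U) = topspace M" and charts: "\<forall>(U, \<phi>)\<in>\<A>. is_chart M U \<phi>"
    unfolding PL_atlas_def by (blast, blast)
  then obtain U \<phi> where U: "(U, \<phi>) \<in> \<A>" "f z \<in> U" using fz by blast
  then have ch: "is_chart M U \<phi>" using charts by blast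
  define N where "N = {y \<in> X. f y \<in> U}"
  have oN: "openin (top_of_set X) N"
  proof -
    have "continuous_map (top_of_set X) M f" by (rule homeomorphic_imp_continuous_map[OF f])
    moreover have "openin M U" using ch by (simp add: is_chart_def)
    ultimately have "openin (top_of_set X) {y \<in> topspace (top_of_set X). f y \<in> U}"
      by (rule openin_continuous_map_preimage)
    then show ?thesis by (simp add: N_def)
  qed
  have UM: "U \<subseteq> topspace M" using ch openin_subset[of M U] by (simp add: is_chart_def)
  have fN: "f ` N = U"
  proof -
    have "f ` X = topspace M" using homeomorphic_imp_surjective_map[OF f] by simp
    show ?thesis
    proof
      show "f ` N \<subseteq> U" by (auto simp: N_def)
      show "U \<subseteq> f ` N"
      proof
        fix y assume "y \<in> U"
        then have "y \<in> f ` X" using UM \<open>f ` X = topspace M\<close> by blast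
        then obtain w where "w \<in> X" "y = f w" by (rule imageE) simp
        then show "y \<in> f ` N" using \<open>y \<in> U\<close> by (simp add: N_def)
      qed
    qed
  qed
  have 1: "homeomorphic_map (subtopology (top_of_set X) N) (subtopology M U) f"
    using homeomorphic_map_subtopologies[OF f, of N U] fN UM openin_subset[OF oN] by (simp add: N_def Int_absorb1)
  have "subtopology (top_of_set X) N = top_of_set N"
    using openin_subset[OF oN] by (simp add: subtopology_subtopology Int_absorb1)
  then have "homeomorphic_map (top_of_set N) (top_of_set (\<phi> ` U)) (\<phi> \<circ> f)"
    using homeomorphic_map_compose[of _ _ f _ \<phi>] 1 ch by (simp add: is_chart_def)
  then obtain k where "homeomorphic_maps (top_of_set N) (top_of_set (\<phi> ` U)) (\<phi> \<circ> f) k"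
    using homeomorphic_map_maps by blast
  moreover have img: "(\<phi> \<circ> f) ` N = \<phi> ` U" by (simp only: image_comp[symmetric] fN)
  ultimately have "homeomorphism N ((\<phi> \<circ> f) ` N) (\<phi> \<circ> f) k"
    by (intro homeomorphismI) (auto simp: homeomorphic_maps_def image_subset_iff Pi_iff)
  moreover have "open ((\<phi> \<circ> f) ` N)" using ch unfolding img by (simp add: is_chart_def)
  moreover have "z \<in> N" using U \<open>z \<in> X\<close> by (simp add: N_def)
  ultimately show "\<exists>N h. openin (top_of_set X) N \<and> z \<in> N \<and> open (h ` N) \<and>
      (\<exists>k :: real^'d \<Rightarrow> 'v. homeomorphism N (h ` N) h k)" using oN by blast
qed

section \<open>Two cones glued along a common base\<close>

lemma aff_dim_Times_UNIV:
  fixes S :: "'a::euclidean_space set"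
  assumes "affine S" "S \<noteq> {}"
  shows "aff_dim (S \<times> (UNIV::real set)) = aff_dim S + 1"
proof -
  obtain z where "z \<in> S" using assms by blast
  then have sub: "subspace ((+) (-z) ` S)" using affine_diffs_subspace assms by blast
  have "aff_dim (S \<times> (UNIV::real set)) = aff_dim ((+) (-(z, 0)) ` (S \<times> (UNIV::real set)))"
    by (simp only: aff_dim_translation_eq)
  also have "(+) (-(z, 0)) ` (S \<times> (UNIV::real set)) = ((+) (-z) ` S) \<times> (UNIV::real set)"
    by (auto simp: image_iff)
  also have "aff_dim \<dots> = dim (((+) (-z) ` S) \<times> (UNIV::real set))"
    using sub by (intro aff_dim_subspace subspace_Times) auto
  also have "\<dots> = dim ((+) (-z) ` S) + 1"
    using sub by (subst dim_Times) auto
  finally have "aff_dim (S \<times> (UNIV::real set)) = int (dim ((+) (-z) ` S)) + 1" by simp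
  then show ?thesis
    using aff_dim_subspace[OF sub] by (simp only: aff_dim_translation_eq)
qed

text \<open>\<open>F\<close> parametrises a two-sided collar of \<open>t\<close>: it fixes
  \<open>t\<close> at \<open>r = 0\<close> and moves towards \<open>a\<close> for
  \<open>r > 0\<close> and towards \<open>b\<close> for \<open>r < 0\<close>. Each side is injective
  because its apex is off the affine hull of \<open>t\<close>, and the sides are kept apart by
  \<open>A \<inter> B = t\<close>.\<close>

lemma join_map:
  fixes t :: "'a::euclidean_space set" and a b :: 'a
  defines "F \<equiv> \<lambda>(u, r::real). (1 - \<bar>r\<bar>) *\<^sub>R u + max r 0 *\<^sub>R a + max (-r) 0 *\<^sub>R b"
  assumes a: "a \<in> A" "a \<notin> affine hull t" "convex A" "t \<subseteq> A"
    and b: "b \<in> B" "b \<notin> affine hull t" "convex B" "t \<subseteq> B"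
    and int: "A \<inter> B = t"
  shows "continuous_on UNIV F"
    and "F ` (t \<times> {-1<..<1}) \<subseteq> A \<union> B"
    and "inj_on F (t \<times> {-1<..<1})"
proof -
  show "continuous_on UNIV F"
    unfolding F_def case_prod_beta by (intro continuous_intros)
  have Fpos: "F (u, r) = (1 - r) *\<^sub>R u + r *\<^sub>R a" if "r \<ge> 0" for u r using that by (simp add: F_def)
  have Fneg: "F (u, r) = (1 - (-r)) *\<^sub>R u + (-r) *\<^sub>R b" if "r \<le> 0" for u r using that by (simp add: F_def)
  have inA: "F (u, r) \<in> A" if "u \<in> t" "r \<ge> 0" "r < 1" for u r
    using that a by (auto simp: Fpos intro!: convexD)
  have inB: "F (u, r) \<in> B" if "u \<in> t" "r \<le> 0" "r > -1" for u r
    using that b unfolding Fneg[OF that(2)] by (intro convexD) auto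
  show "F ` (t \<times> {-1<..<1}) \<subseteq> A \<union> B"
  proof clarsimp
    fix u r assume "u \<in> t" "-1 < r" "r < 1" "F (u, r) \<notin> B"
    then show "F (u, r) \<in> A" using inA[of u r] inB[of u r] by (cases "r \<ge> 0") auto
  qed
  have off: "(1 - r) *\<^sub>R u + r *\<^sub>R v \<notin> affine hull t"
    if "u \<in> t" "v \<notin> affine hull t" "r \<noteq> 0" for u v r
  proof
    assume *: "(1 - r) *\<^sub>R u + r *\<^sub>R v \<in> affine hull t"
    have "(1 - 1/r) *\<^sub>R u + (1/r) *\<^sub>R ((1 - r) *\<^sub>R u + r *\<^sub>R v) \<in> affine hull t"
      by (rule mem_affine) (use * that in \<open>auto simp: hull_inc\<close>)
    moreover have "(1 - 1/r) *\<^sub>R u + (1/r) *\<^sub>R ((1 - r) *\<^sub>R u + r *\<^sub>R v) = v"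
    proof -
      have "(1 - 1/r) *\<^sub>R u + (1/r) *\<^sub>R ((1 - r) *\<^sub>R u + r *\<^sub>R v)
          = ((1 - 1/r) + (1/r) * (1 - r)) *\<^sub>R u + v"
        using that by (simp add: scaleR_add_right scaleR_add_left)
      moreover have "(1 - 1/r) + (1/r) * (1 - r) = 0" using that by (simp add: field_simps)
      ultimately show ?thesis by simp
    qed
    ultimately show False using that by simp
  qed
  \<comment> \<open>If \<open>r \<noteq> r'\<close>, the equation could be solved for
    \<open>v\<close> as an affine combination of \<open>u\<close> and \<open>u'\<close>.\<close>
  have inj: "u = u' \<and> r = r'"
    if "u \<in> t" "u' \<in> t" "v \<notin> affine hull t" "r < 1"
      "(1 - r) *\<^sub>R u + r *\<^sub>R v = (1 - r') *\<^sub>R u' + r' *\<^sub>R v" for u u' r r' v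
  proof -
    have "r = r'"
    proof (rule ccontr)
      assume ne: "r \<noteq> r'"
      define c where "c = 1 / (r - r')"
      have "(r - r') *\<^sub>R v = (1 - r') *\<^sub>R u' - (1 - r) *\<^sub>R u" using that(5) by (simp add: algebra_simps)
      moreover have "v = c *\<^sub>R ((r - r') *\<^sub>R v)" using ne by (simp add: c_def)
      ultimately have "v = c *\<^sub>R ((1 - r') *\<^sub>R u' - (1 - r) *\<^sub>R u)" by simp
      then have "v = (c * (1 - r')) *\<^sub>R u' + (- c * (1 - r)) *\<^sub>R u" by (simp add: scaleR_right_diff_distrib)
      moreover have "c * (1 - r') + (- c * (1 - r)) = 1"
      proof -
        have "c * (1 - r') + (- c * (1 - r)) = c * (r - r')" by (simp add: algebra_simps)
        then show ?thesis using ne by (simp add: c_def)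
      qed
      ultimately have "v \<in> affine hull t"
        using mem_affine[of "affine hull t" u' u "c * (1 - r')" "- c * (1 - r)"] that
        by (simp add: hull_inc)
      then show False using that by simp
    qed
    then show ?thesis using that by auto
  qed
  \<comment> \<open>A common value of the two sides lies in \<open>A \<inter> B = t\<close>, but for
    \<open>r' < 0\<close> it is off the affine hull of \<open>t\<close>.\<close>
  have cross: False if "u \<in> t" "u' \<in> t" "0 \<le> r" "r < 1" "r' < 0" "-1 < r'" "F (u, r) = F (u', r')" for u u' r r'
  proof -
    have "F (u', r') \<in> A" using inA[OF that(1,3,4)] that(7) by metis
    moreover have "F (u', r') \<in> B" using inB[of u' r'] that by simp
    ultimately have "F (u', r') \<in> t" using int by auto
    then show False using off[of u' b "- r'"] that b hull_inc[of _ t affine] by (simp add: Fneg)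
  qed
  show "inj_on F (t \<times> {-1<..<1})"
  proof (rule inj_onI, clarsimp)
    fix u r u' r' assume *: "u \<in> t" "u' \<in> t" "-1 < r" "r < 1" "-1 < r'" "r' < 1" "F (u, r) = F (u', r')"
    consider "r \<ge> 0" "r' \<ge> 0" | "r < 0" "r' < 0" | "r \<ge> 0" "r' < 0" | "r < 0" "r' \<ge> 0" by linarith
    then show "u = u' \<and> r = r'"
    proof cases
      case 1 then show ?thesis using inj[of u u' a r r'] * a by (simp add: Fpos)
    next
      case 2 then show ?thesis using inj[of u u' b "-r" "-r'"] * b by (simp add: Fneg)
    next
      case 3 then show ?thesis using cross[of u u' r r'] * by simp
    next
      case 4 then show ?thesis using cross[of u' u r' r] * by simp
    qed
  qed
qed

section \<open>Convex subsets of locally Euclidean sets\<close>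

text \<open>A chart at a relative interior point of \<open>S\<close> embeds a nonempty open piece of
  the affine hull of \<open>S\<close> into \<open>'e\<close>, so invariance of dimension
  applies.\<close>

lemma locally_euclidean_aff_dim_le:
  fixes X :: "'v::euclidean_space set"
  assumes loc: "locally_euclidean TYPE('e::euclidean_space) X" and "convex S" "S \<subseteq> X"
  shows "aff_dim S \<le> DIM('e)"
proof (cases "S = {}")
  case False
  then obtain z where z: "z \<in> rel_interior S" using \<open>convex S\<close> rel_interior_eq_empty by blast
  then have "z \<in> X" using rel_interior_subset \<open>S \<subseteq> X\<close> by blast
  then obtain N h and k :: "'e \<Rightarrow> 'v" where N: "openin (top_of_set X) N" "z \<in> N" "homeomorphism N (h ` N) h k"
    using loc unfolding locally_euclidean_def by blast
  then obtain U where U: "open U" "N = X \<inter> U" by (auto simp: openin_open)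
  define W where "W = rel_interior S \<inter> U"
  have "W \<subseteq> N" using rel_interior_subset[of S] \<open>S \<subseteq> X\<close> by (auto simp: W_def U)
  have "aff_dim (affine hull S) \<le> aff_dim (UNIV :: 'e set)"
  proof (rule invariance_of_dimension_affine_sets)
    show "openin (top_of_set (affine hull S)) W"
      unfolding W_def by (intro openin_Int_open openin_rel_interior U)
    show "continuous_on W h" "inj_on h W"
      using N(3) \<open>W \<subseteq> N\<close> by (auto simp: homeomorphism_def intro: continuous_on_subset inj_on_inverseI)
    show "W \<noteq> {}" using z N(2) by (auto simp: W_def U)
  qed auto
  then show ?thesis by simp
qed simp

text \<open>Near \<open>z\<close> the inverse chart maps an open subset of \<open>'e\<close>
  injectively into the affine hull of \<open>S\<close>, whose dimension is at most
  \<open>DIM('e)\<close>. Invariance of domain makes the image relatively open, and invariance of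
  dimension gives equality.\<close>

lemma locally_euclidean_convex_nbhd:
  fixes X :: "'v::euclidean_space set"
  assumes loc: "locally_euclidean TYPE('e::euclidean_space) X" and z: "z \<in> X"
    and U: "open U" "z \<in> U" "X \<inter> U \<subseteq> S" and S: "convex S" "S \<subseteq> X"
  shows "z \<in> rel_interior S" and "aff_dim S = DIM('e)"
proof -
  have dim: "aff_dim S \<le> DIM('e)" by (rule locally_euclidean_aff_dim_le[OF loc S])
  obtain N h and k :: "'e \<Rightarrow> 'v"
    where N: "openin (top_of_set X) N" "z \<in> N" "open (h ` N)" and hom: "homeomorphism N (h ` N) h k"
    using loc z unfolding locally_euclidean_def by blast
  define W where "W = N \<inter> U"
  have W: "z \<in> W" "W \<subseteq> S" "W \<subseteq> N"
    using N U openin_subset[OF N(1)] by (auto simp: W_def)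
  have "openin (top_of_set N) W" using U(1) by (auto simp: W_def openin_open)
  then have "openin (top_of_set (h ` N)) (h ` W)" by (rule homeomorphism_imp_open_map[OF hom])
  then have ohW: "open (h ` W)" using N(3) openin_open_trans by blast
  have kh: "k (h y) = y" if "y \<in> W" for y using hom W(3) that by (auto simp: homeomorphism_def)
  then have khW: "k ` h ` W = W" by (simp add: image_image)
  have sub: "h ` W \<subseteq> h ` N" using W by blast
  have cont: "continuous_on (h ` W) k" using hom sub continuous_on_subset by (auto simp: homeomorphism_def)
  have inj: "inj_on k (h ` W)" by (rule inj_on_inverseI[of _ h]) (auto simp: kh)
  have into: "k \<in> h ` W \<rightarrow> affine hull S"
    using khW W(2) hull_subset[of S affine] by blast
  have "openin (top_of_set (affine hull S)) (k ` h ` W)"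
    by (rule invariance_of_domain_affine_sets[where U = UNIV]) (use ohW cont inj into dim in auto)
  then have "W \<subseteq> rel_interior S" unfolding khW by (intro rel_interior_maximal W)
  then show "z \<in> rel_interior S" using W by blast
  have "aff_dim (UNIV :: 'e set) \<le> aff_dim (affine hull S)"
    by (rule invariance_of_dimension_affine_sets[where S = "h ` W" and f = k])
      (use ohW cont inj into W in auto)
  then show "aff_dim S = DIM('e)" using dim by simp
qed

text \<open>
  Around a relative interior point of \<open>\<tau>\<close> the polyhedron is the union of the maximal simplices
  containing \<open>\<tau>\<close>, which are half-discs glued along \<open>\<tau>\<close>. By invariance of domain, a single half-disc
  is not locally Euclidean along \<open>\<tau>\<close>, and the union of two of them is already open, which leaves no
  room for a third.
\<close>

lemma card_cofaces_eq_2: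
  fixes T :: "'v::euclidean_space set set"
  assumes T: "simplicial_complex T" and loc: "locally_euclidean TYPE('e::euclidean_space) (\<Union>T)"
    and \<tau>: "\<tau> \<in> T" "aff_dim \<tau> = int (DIM('e)) - 1"
  shows "card {\<sigma> \<in> T. aff_dim \<sigma> = DIM('e) \<and> \<tau> \<subseteq> \<sigma>} = 2"
proof -
  define S where "S = {\<sigma> \<in> T. aff_dim \<sigma> = DIM('e) \<and> \<tau> \<subseteq> \<sigma>}"
  have finT: "finite T" using T by (simp add: simplicial_complex_def)
  have simp: "\<exists>n. n simplex \<sigma>" if "\<sigma> \<in> T" for \<sigma> using T that by (simp add: simplicial_complex_def)
  have conv: "convex \<sigma>" and clos: "closed \<sigma>" if "\<sigma> \<in> T" for \<sigma>
    using simp[OF that] convex_simplex closed_simplex by blast+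
  have inter: "\<sigma> \<inter> \<sigma>' face_of \<sigma>" if "\<sigma> \<in> T" "\<sigma>' \<in> T" for \<sigma> \<sigma>'
    using T that by (simp add: simplicial_complex_def)
  have dim: "aff_dim \<sigma> \<le> DIM('e)" if "\<sigma> \<in> T" for \<sigma>
    using locally_euclidean_aff_dim_le[OF loc conv[OF that]] that by blast
  have "\<tau> \<noteq> {}" using \<tau>(2) by auto
  then obtain z where z: "z \<in> rel_interior \<tau>" using conv[OF \<tau>(1)] rel_interior_eq_empty by blast
  then have "z \<in> \<tau>" using rel_interior_subset by blast
  have face: "\<tau> face_of \<sigma>" if "\<sigma> \<in> T" "\<tau> \<subseteq> \<sigma>" for \<sigma>
    using inter[OF that(1) \<tau>(1)] that(2) by (simp add: Int_absorb1)
  have coface: "\<sigma> = \<tau> \<or> \<sigma> \<in> S" if "\<sigma> \<in> T" "\<tau> \<subseteq> \<sigma>" for \<sigma>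
  proof (cases "\<sigma> = \<tau>")
    case False
    then have "aff_dim \<tau> < aff_dim \<sigma>" using face_of_aff_dim_lt[OF conv face] that by blast
    then show ?thesis using dim[OF that(1)] \<tau>(2) that by (simp add: S_def)
  qed simp
  \<comment> \<open>A neighbourhood of \<open>z\<close> that meets only simplices containing
    \<open>z\<close>; these contain \<tau> because \<open>z\<close> is in its relative
    interior.\<close>
  define U where "U = - \<Union>{\<sigma> \<in> T. z \<notin> \<sigma>}"
  have "open U" unfolding U_def using finT clos by (intro open_Compl closed_Union) auto
  have "z \<in> U" by (auto simp: U_def)
  have star: "\<exists>\<sigma>\<in>insert \<tau> S. y \<in> \<sigma>" if "y \<in> \<Union>T \<inter> U" for y
  proof -
    obtain \<sigma> where \<sigma>: "\<sigma> \<in> T" "y \<in> \<sigma>" "z \<in> \<sigma>" using \<open>y \<in> \<Union>T \<inter> U\<close> by (auto simp: U_def)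
    have "\<tau> \<subseteq> \<tau> \<inter> \<sigma>"
      using z \<open>z \<in> \<sigma>\<close> \<open>z \<in> \<tau>\<close> by (intro subset_of_face_of[OF inter[OF \<tau>(1) \<sigma>(1)]]) auto
    then show ?thesis using coface \<sigma> by blast
  qed
  \<comment> \<open>With no coface other than \<sigma>, the polyhedron near \<open>z\<close> lies in
    \<sigma>, so \<open>z\<close> is in the relative interior of \<sigma>; but it also lies in the
    proper face \<tau>. The choice \<open>\<sigma> = \<tau>\<close> excludes an empty
    \<open>S\<close>, and \<open>\<sigma> \<in> S\<close> a singleton.\<close>
  have ge2: "\<not> S \<subseteq> {\<sigma>}" if \<sigma>: "\<sigma> \<in> T" "\<tau> \<subseteq> \<sigma>" for \<sigma>
  proof
    assume "S \<subseteq> {\<sigma>}"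
    then have sub: "\<Union>T \<inter> U \<subseteq> \<sigma>" using star \<sigma> by blast
    have zX: "z \<in> \<Union>T" using \<open>z \<in> \<tau>\<close> \<tau> by blast
    note nb = locally_euclidean_convex_nbhd[OF loc zX \<open>open U\<close> \<open>z \<in> U\<close> sub conv[OF \<sigma>(1)]]
    have "\<sigma> \<subseteq> \<Union>T" using \<sigma> by blast
    then have "z \<in> rel_interior \<sigma>" "aff_dim \<sigma> = DIM('e)" using nb by auto
    then have "\<sigma> \<noteq> \<tau>" using \<tau>(2) by auto
    then have "\<tau> \<inter> rel_interior \<sigma> = {}" using face_of_disjoint_rel_interior[OF face[OF \<sigma>]] by blast
    then show False using \<open>z \<in> \<tau>\<close> \<open>z \<in> rel_interior \<sigma>\<close> by blast
  qed
  \<comment> \<open>The intersection is a proper face of \<sigma>, so of dimension below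
    \<open>DIM('e)\<close>; it has \<tau> as a face, which leaves no room for a strict
    inclusion.\<close>
  have meet: "\<sigma> \<inter> \<sigma>' = \<tau>" if "\<sigma> \<in> S" "\<sigma>' \<in> S" "\<sigma> \<noteq> \<sigma>'" for \<sigma> \<sigma>'
  proof -
    have in_T: "\<sigma> \<in> T" "\<sigma>' \<in> T" and dims: "aff_dim \<sigma> = DIM('e)" "aff_dim \<sigma>' = DIM('e)"
      and sub: "\<tau> \<subseteq> \<sigma> \<inter> \<sigma>'" using that by (auto simp: S_def)
    have f: "\<sigma> \<inter> \<sigma>' face_of \<sigma>" "\<sigma> \<inter> \<sigma>' face_of \<sigma>'"
      using inter[OF in_T] inter[OF in_T(2,1)] by (simp_all add: Int_commute)
    have "\<sigma> \<inter> \<sigma>' \<noteq> \<sigma>"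
    proof
      assume "\<sigma> \<inter> \<sigma>' = \<sigma>"
      then have "aff_dim \<sigma> < aff_dim \<sigma>'"
        using face_of_aff_dim_lt[OF conv[OF in_T(2)] f(2)] that(3) by auto
      then show False using dims by simp
    qed
    then have "aff_dim (\<sigma> \<inter> \<sigma>') < DIM('e)"
      using face_of_aff_dim_lt[OF conv[OF in_T(1)] f(1)] dims by simp
    moreover have "\<tau> face_of (\<sigma> \<inter> \<sigma>')"
      using face_of_subset[OF face[OF in_T(1)]] sub by blast
    moreover have "convex (\<sigma> \<inter> \<sigma>')" using conv in_T convex_Int by blast
    ultimately show ?thesis using face_of_aff_dim_lt[of "\<sigma> \<inter> \<sigma>'" \<tau>] \<tau>(2) by force
  qed
  have apex: "\<exists>v\<in>\<sigma>. v \<notin> affine hull \<tau>" if "\<sigma> \<in> S" for \<sigma>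
  proof (rule ccontr)
    assume "\<not> ?thesis"
    then have "\<sigma> \<subseteq> affine hull \<tau>" by blast
    then have "aff_dim \<sigma> \<le> aff_dim \<tau>" using aff_dim_subset[of \<sigma> "affine hull \<tau>"] by simp
    then show False using that \<tau>(2) by (simp add: S_def)
  qed
  have no_third: False if S3: "\<sigma>1 \<in> S" "\<sigma>2 \<in> S" "\<sigma>3 \<in> S" and ne: "\<sigma>1 \<noteq> \<sigma>2" "\<sigma>1 \<noteq> \<sigma>3" "\<sigma>2 \<noteq> \<sigma>3" for \<sigma>1 \<sigma>2 \<sigma>3
  proof -
    have in_T: "\<sigma>1 \<in> T" "\<sigma>2 \<in> T" "\<sigma>3 \<in> T" and sub: "\<tau> \<subseteq> \<sigma>1" "\<tau> \<subseteq> \<sigma>2" "\<tau> \<subseteq> \<sigma>3"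
      using S3 by (auto simp: S_def)
    obtain a b c where a: "a \<in> \<sigma>1" "a \<notin> affine hull \<tau>" and b: "b \<in> \<sigma>2" "b \<notin> affine hull \<tau>"
      and c: "c \<in> \<sigma>3" "c \<notin> affine hull \<tau>"
      using apex S3 by meson
    define F where "F = (\<lambda>(u, r::real). (1 - \<bar>r\<bar>) *\<^sub>R u + max r 0 *\<^sub>R a + max (-r) 0 *\<^sub>R b)"
    have contF: "continuous_on UNIV F" and F_into: "F ` (\<tau> \<times> {-1<..<1}) \<subseteq> \<sigma>1 \<union> \<sigma>2"
      and injF: "inj_on F (\<tau> \<times> {-1<..<1})"
      unfolding F_def
      using join_map[OF a conv[OF in_T(1)] sub(1) b conv[OF in_T(2)] sub(2) meet[OF S3(1,2) ne(1)]] by blast+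
    have "z \<in> \<Union>T" using \<open>z \<in> \<tau>\<close> \<tau> by blast
    then obtain N h and k :: "'e \<Rightarrow> 'v"
      where N: "openin (top_of_set (\<Union>T)) N" "z \<in> N" "open (h ` N)" and hom: "homeomorphism N (h ` N) h k"
      using loc unfolding locally_euclidean_def by blast
    obtain V where V: "open V" "N = \<Union>T \<inter> V" using N(1) by (auto simp: openin_open)
    \<comment> \<open>The relative interior makes \<open>B\<close> open in
      \<open>affine hull \<tau>\<close> times the line, and the preimage of \<open>V\<close> keeps
      the image of \<open>B\<close> inside the chart domain.\<close>
    define B where "B = (rel_interior \<tau> \<times> {-1<..<1}) \<inter> F -` V"
    have B\<tau>: "B \<subseteq> \<tau> \<times> {-1<..<1}" using rel_interior_subset by (auto simp: B_def)
    have FB12: "F ` B \<subseteq> \<sigma>1 \<union> \<sigma>2" using F_into B\<tau> by blast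
    then have FBN: "F ` B \<subseteq> N" using in_T by (auto simp: V B_def)
    \<comment> \<open>The product of \<open>affine hull \<tau>\<close> with the line has dimension
      \<open>DIM('e)\<close>, so invariance of domain applies to \<open>h \<circ> F\<close>.\<close>
    have hFB: "open ((h \<circ> F) ` B)"
    proof -
      have "openin (top_of_set (UNIV :: 'e set)) ((h \<circ> F) ` B)"
      proof (rule invariance_of_domain_affine_sets)
        have "open (F -` V)" using contF V(1) open_vimage by blast
        moreover have "openin (top_of_set ((affine hull \<tau>) \<times> (UNIV::real set))) (rel_interior \<tau> \<times> {-1<..<1})"
          by (rule openin_Times[OF openin_rel_interior]) simp
        ultimately show "openin (top_of_set ((affine hull \<tau>) \<times> (UNIV::real set))) B"
          unfolding B_def by (intro openin_Int_open)
        show "affine ((affine hull \<tau>) \<times> (UNIV::real set))" by (auto simp: affine_def intro: mem_affine[OF affine_affine_hull])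
        show "aff_dim (UNIV :: 'e set) \<le> aff_dim ((affine hull \<tau>) \<times> (UNIV::real set))"
          using \<tau>(2) \<open>\<tau> \<noteq> {}\<close> by (subst aff_dim_Times_UNIV) auto
        show "continuous_on B (h \<circ> F)"
          using contF hom FBN by (intro continuous_on_compose) (auto simp: homeomorphism_def intro: continuous_on_subset)
        have "inj_on h (F ` B)" using hom FBN by (auto simp: homeomorphism_def intro!: inj_on_inverseI[of _ k])
        then show "inj_on (h \<circ> F) B" using injF B\<tau> by (intro comp_inj_on) (auto intro: inj_on_subset)
      qed auto
      then show ?thesis by simp
    qed
    have "openin (top_of_set (\<Union>T)) (F ` B)"
    proof -
      have "(h \<circ> F) ` B \<subseteq> h ` N" using FBN by auto
      then have "openin (top_of_set (h ` N)) ((h \<circ> F) ` B)" by (rule open_openin_trans[OF N(3) hFB])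
      then have "openin (top_of_set N) (k ` (h \<circ> F) ` B)"
        using homeomorphism_imp_open_map[OF homeomorphism_symD[OF hom]] by blast
      moreover have "k ` (h \<circ> F) ` B = F ` B"
      proof -
        have "k (h y) = y" if "y \<in> N" for y using hom that by (simp add: homeomorphism_def)
        then have "k (h (F p)) = F p" if "p \<in> B" for p using FBN that by blast
        then show ?thesis by (simp add: image_image cong: image_cong_simp)
      qed
      ultimately show ?thesis using N(1) openin_trans[of N] by auto
    qed
    then obtain W where W: "open W" "F ` B = \<Union>T \<inter> W" by (auto simp: openin_open)
    have "F (z, 0) = z" by (simp add: F_def)
    moreover have "(z, 0) \<in> B" using z N(2) by (simp add: B_def \<open>F (z, 0) = z\<close> V)
    ultimately have "z \<in> W" using W(2) by (metis Int_iff image_eqI)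
    \<comment> \<open>A short move from \<open>z\<close> towards \<open>c\<close> stays in the open
      set covered by \<sigma>1 and \<sigma>2 but also in \<sigma>3, hence in \<tau>. Since \<tau> is
      a face of \<sigma>3, it would contain the end \<open>c\<close> of the segment.\<close>
    define g where "g s = (1 - s) *\<^sub>R z + s *\<^sub>R c" for s :: real
    have "continuous_on UNIV g" unfolding g_def by (intro continuous_intros)
    then have "open (g -` W)" using W(1) open_vimage by blast
    moreover have "0 \<in> g -` W" using \<open>z \<in> W\<close> by (simp add: g_def)
    ultimately obtain e where e: "e > 0" "ball 0 e \<subseteq> g -` W" using open_contains_ball by blast
    define s where "s = min (e/2) (1/2)"
    have s: "0 < s" "s < 1" "s \<in> ball 0 e" using e by (auto simp: s_def)
    then have "g s \<in> W" using e by blast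
    have "z \<in> \<sigma>3" using \<open>z \<in> \<tau>\<close> sub by blast
    then have "g s \<in> \<sigma>3" using s c conv[OF in_T(3)] by (auto simp: g_def intro!: convexD)
    then have "g s \<in> \<sigma>1 \<union> \<sigma>2" using \<open>g s \<in> W\<close> W(2) in_T FB12 by blast
    then have "g s \<in> \<tau>" using \<open>g s \<in> \<sigma>3\<close> meet[OF S3(1,3) ne(2)] meet[OF S3(2,3) ne(3)] by blast
    moreover have "z \<noteq> c" using c(2) \<open>z \<in> \<tau>\<close> hull_inc[of z \<tau> affine] by blast
    then have "g s \<in> open_segment z c" using s by (auto simp: in_segment g_def)
    ultimately have "c \<in> \<tau>"
      using face_ofD[OF face[OF in_T(3) sub(3)]] \<open>z \<in> \<sigma>3\<close> c(1) by blast
    then show False using c(2) hull_inc[of c \<tau> affine] by blast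
  qed
  have "S \<noteq> {}" using ge2[of \<tau>] \<tau> by blast
  then obtain \<sigma> where \<sigma>: "\<sigma> \<in> S" by blast
  then have "\<not> S \<subseteq> {\<sigma>}" using ge2[of \<sigma>] by (simp add: S_def)
  then obtain \<sigma>' where \<sigma>': "\<sigma>' \<in> S" "\<sigma>' \<noteq> \<sigma>" by blast
  have "\<rho> = \<sigma> \<or> \<rho> = \<sigma>'" if "\<rho> \<in> S" for \<rho>
    using no_third[OF \<sigma> \<sigma>'(1) that] \<sigma>'(2) by metis
  then have "S = {\<sigma>, \<sigma>'}" using \<sigma> \<sigma>'(1) by blast
  then show ?thesis using \<sigma>'(2) by (simp add: S_def)
qed

section \<open>Counting over the triangulation\<close>

text \<open>Each affine hull lies in a hyperplane and so is negligible; finitely many of them cannot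
  cover the space.\<close>

lemma ex_point_outside_affine_hulls:
  fixes \<F> :: "'a::euclidean_space set set"
  assumes "finite \<F>" "\<And>S. S \<in> \<F> \<Longrightarrow> aff_dim S < DIM('a)"
  obtains y where "\<And>S. S \<in> \<F> \<Longrightarrow> y \<notin> affine hull S"
proof -
  have "negligible (affine hull S)" if "S \<in> \<F>" for S
  proof -
    have "aff_dim (affine hull S) < DIM('a)" using assms(2)[OF that] by simp
    then obtain a b where "a \<noteq> 0" "affine hull S \<subseteq> {x. a \<bullet> x = b}"
      using aff_lowdim_subset_hyperplane by metis
    then show ?thesis using negligible_hyperplane negligible_subset by blast
  qed
  then have "negligible (\<Union>((hull) affine ` \<F>))" using assms(1) by (intro negligible_Union) auto
  then have "\<Union>((hull) affine ` \<F>) \<noteq> UNIV" using non_negligible_UNIV by metis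
  then show ?thesis using that by blast
qed

section \<open>Vertices and facets of a simplex\<close>

lemma vertices_convex_hull:
  "\<not> affine_dependent C \<Longrightarrow> vertices (convex hull C) = C"
  by (simp add: vertices_def extreme_point_of_convex_hull_affine_independent)

lemma simplex_vertices:
  assumes "n simplex \<sigma>"
  shows "\<not> affine_dependent (vertices \<sigma>)" "int (card (vertices \<sigma>)) = n + 1"
    "convex hull (vertices \<sigma>) = \<sigma>"
proof -
  obtain C where C: "\<not> affine_dependent C" "int (card C) = n + 1" "\<sigma> = convex hull C"
    using assms by (auto simp: simplex_def)
  then have "vertices \<sigma> = C" by (simp add: vertices_convex_hull)
  then show "\<not> affine_dependent (vertices \<sigma>)" "int (card (vertices \<sigma>)) = n + 1"
    "convex hull (vertices \<sigma>) = \<sigma>" using C by auto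
qed

text \<open>Turns deletion of a vertex into passage to a facet in \<open>T\<close>. Surjectivity
  uses that a simplex of \<open>T\<close> inside \<sigma> meets \<sigma> in a face, hence is spanned
  by vertices of \<sigma>.\<close>

lemma bij_betw_facets:
  fixes T :: "'v::euclidean_space set set"
  assumes T: "simplicial_complex T" and \<sigma>: "\<sigma> \<in> T" "n simplex \<sigma>"
  shows "bij_betw (\<lambda>v. convex hull (vertices \<sigma> - {v})) (vertices \<sigma>)
           {\<tau> \<in> T. (n - 1) simplex \<tau> \<and> \<tau> \<subseteq> \<sigma>}"
proof (rule bij_betwI')
  let ?C = "vertices \<sigma>"
  note C = simplex_vertices[OF \<sigma>(2)]
  have indep: "\<not> affine_dependent (?C - {v})" for v using C(1) affine_independent_Diff by blast
  have fin: "finite ?C" using C(1) aff_independent_finite by blast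
  show "convex hull (?C - {v}) = convex hull (?C - {w}) \<longleftrightarrow> v = w" if "v \<in> ?C" "w \<in> ?C" for v w
    using that indep vertices_convex_hull by (metis Diff_iff insertI1 singletonD)
  show "convex hull (?C - {v}) \<in> {\<tau> \<in> T. (n - 1) simplex \<tau> \<and> \<tau> \<subseteq> \<sigma>}" if "v \<in> ?C" for v
  proof -
    have "convex hull (?C - {v}) face_of convex hull ?C"
      using face_of_convex_hull_affine_independent[OF C(1)] by blast
    then have "convex hull (?C - {v}) face_of \<sigma>" using C(3) by simp
    then have "convex hull (?C - {v}) \<in> T" "convex hull (?C - {v}) \<subseteq> \<sigma>"
      using T \<sigma>(1) face_of_imp_subset by (auto simp: simplicial_complex_def)
    moreover have "int (card (?C - {v})) = n"
      using that fin C(2) card_gt_0_iff[of ?C] by (auto simp: card_Diff_singleton_if)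
    then have "(n - 1) simplex (convex hull (?C - {v}))"
      using indep by (intro simplex_convex_hull) simp
    ultimately show ?thesis by simp
  qed
  show "\<exists>v\<in>?C. \<tau> = convex hull (?C - {v})" if "\<tau> \<in> {\<tau> \<in> T. (n - 1) simplex \<tau> \<and> \<tau> \<subseteq> \<sigma>}" for \<tau>
  proof -
    have \<tau>: "\<tau> \<in> T" "(n - 1) simplex \<tau>" "\<tau> \<subseteq> \<sigma>" using that by auto
    have "\<sigma> \<inter> \<tau> face_of \<sigma>" using T \<sigma>(1) \<tau>(1) unfolding simplicial_complex_def by blast
    then have "\<tau> face_of convex hull ?C" using \<tau>(3) C(3) by (simp add: Int_absorb1)
    then obtain c where c: "c \<subseteq> ?C" "\<tau> = convex hull c"
      using face_of_convex_hull_affine_independent[OF C(1)] by blast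
    then have "vertices \<tau> = c"
      using vertices_convex_hull C(1) affine_independent_subset by blast
    then have "int (card c) = n" using simplex_vertices(2)[OF \<tau>(2)] by simp
    then have "card (?C - c) = 1" using c(1) C(2) fin by (simp add: card_Diff_subset finite_subset)
    then obtain v where "?C - c = {v}" by (auto simp: card_1_singleton_iff)
    then have "v \<in> ?C" "c = ?C - {v}" using c(1) by auto
    then show ?thesis using c(2) by blast
  qed
qed

section \<open>Double counting of simplices and facets modulo 2\<close>

theorem theorem3p1:
  fixes n :: nat
    and p :: "nat \<Rightarrow> real^'d"
    and x :: "real^'d"
    and M :: "'m topology"
    and \<A> :: "('m set \<times> ('m \<Rightarrow> real^'d)) set"
    and T :: "'v::euclidean_space set set"
    and L :: "'v \<Rightarrow> nat"
  assumes "\<And>S. S \<in> cov (p ` {1..n}) x \<Longrightarrow> aff_dim S = int CARD('d)"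
    and "closed_PL_manifold M \<A>"
    and "triangulates T M"
    and "L \<in> vertex_set T \<rightarrow> {1..n}"
  shows "even (card {\<sigma> \<in> T. int CARD('d) simplex \<sigma> \<and> inj_on L (vertices \<sigma>) \<and>
                        convex hull (p ` L ` vertices \<sigma>) \<in> cov (p ` {1..n}) x})"
proof -
  let ?d = "CARD('d)"
  have T: "simplicial_complex T" and finT: "finite T"
    using assms(3) by (auto simp: triangulates_def simplicial_complex_def)
  have loc: "locally_euclidean TYPE(real^'d) (\<Union>T)"
    using closed_PL_manifold_imp_locally_euclidean assms(2,3) unfolding triangulates_def by blast
  \<comment> \<open>The hypothesis on \<open>cov\<close> acts as general position: a hull of at most
    \<open>CARD('d)\<close> points containing \<open>x\<close> would be a member of
    \<open>cov\<close> of too small a dimension.\<close>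
  have gen: "x \<notin> convex hull (p ` K)" if K: "K \<subseteq> {1..n}" "card K \<le> ?d" for K
  proof
    assume x: "x \<in> convex hull (p ` K)"
    have fin: "finite (p ` K)" using K finite_subset by blast
    have "p ` K \<noteq> {}" using x by auto
    then have "1 \<le> card (p ` K)" using fin by (simp add: Suc_le_eq card_gt_0_iff)
    moreover have cK: "card (p ` K) \<le> ?d" using card_image_le[of K p] K finite_subset[of K] by force
    ultimately have "convex hull (p ` K) \<in> cov (p ` {1..n}) x"
      using x K(1) unfolding cov_def spanned_simplices_def by fastforce
    then have "aff_dim (p ` K) = ?d" using assms(1)[of "convex hull (p ` K)"] by (simp add: aff_dim_convex_hull)
    then show False using aff_dim_le_card[OF fin] cK by linarith
  qed
  \<comment> \<open>Each excluded hull is spanned by at most \<open>CARD('d)\<close> points,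
    including \<open>x\<close>, so has dimension below \<open>CARD('d)\<close>.\<close>
  obtain y where y: "\<And>K. K \<subseteq> {1..n} \<Longrightarrow> card K < ?d \<Longrightarrow> y \<notin> affine hull (insert x (p ` K))"
  proof -
    define \<K> where "\<K> = {K. K \<subseteq> {1..n} \<and> card K < ?d}"
    have "finite ((\<lambda>K. insert x (p ` K)) ` \<K>)" by (simp add: \<K>_def)
    moreover have "aff_dim S < DIM(real^'d)" if S: "S \<in> (\<lambda>K. insert x (p ` K)) ` \<K>" for S
    proof -
      obtain K where K: "K \<subseteq> {1..n}" "card K < ?d" "S = insert x (p ` K)" using S by (auto simp: \<K>_def)
      then have fin: "finite K" using finite_subset by blast
      have "card S \<le> Suc (card K)"
        using card_insert_le_m1 card_image_le[OF fin, of p] fin by (simp add: K(3) card_insert_if)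
      then show ?thesis using aff_dim_le_card[of S] fin K by simp
    qed
    ultimately obtain y where "\<And>S. S \<in> (\<lambda>K. insert x (p ` K)) ` \<K> \<Longrightarrow> y \<notin> affine hull S"
      using ex_point_outside_affine_hulls by metis
    then show thesis by (intro that[of y]) (simp add: \<K>_def)
  qed
  \<comment> \<open>If \<open>x\<close> is a convex combination of \<open>y\<close> and
    \<open>b\<close> with positive weight on \<open>y\<close>, solving for \<open>y\<close> puts it
    into an excluded affine hull; weight 0 contradicts \<open>gen\<close>.\<close>
  have gen_y: "x \<notin> convex hull (insert y (p ` K))" if K: "K \<subseteq> {1..n}" "card K < ?d" for K
  proof
    assume x: "x \<in> convex hull (insert y (p ` K))"
    show False
    proof (cases "K = {}")
      case True
      then show False using x y[OF K] by simp
    next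
      case False
      then obtain u v b where b: "0 \<le> u" "0 \<le> v" "u + v = 1" "b \<in> convex hull (p ` K)" "x = u *\<^sub>R y + v *\<^sub>R b"
        using x by (auto simp: convex_hull_insert)
      show False
      proof (cases "u = 0")
        case True
        then show False using b gen[OF K(1)] K(2) by simp
      next
        case False
        have "(1/u) *\<^sub>R x + (1 - 1/u) *\<^sub>R b = y + (v/u + 1 - 1/u) *\<^sub>R b"
          using False by (simp add: b(5) algebra_simps)
        also have "v/u + 1 - 1/u = 0" using False b(3) by (simp add: field_simps)
        finally have "y = (1/u) *\<^sub>R x + (1 - 1/u) *\<^sub>R b" by simp
        moreover have "b \<in> affine hull (insert x (p ` K))"
          using b(4) convex_hull_subset_affine_hull hull_mono[of "p ` K" "insert x (p ` K)" affine] by blast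
        moreover have "x \<in> affine hull (insert x (p ` K))" by (simp add: hull_inc)
        ultimately have "y \<in> affine hull (insert x (p ` K))"
          using mem_affine[OF affine_affine_hull, of x _ b "1/u" "1 - 1/u"] by simp
        then show False using y[OF K] by simp
      qed
    qed
  qed
  define D where "D = {\<sigma> \<in> T. int ?d simplex \<sigma>}"
  define E where "E = {\<tau> \<in> T. (int ?d - 1) simplex \<tau>}"
  define g where "g \<sigma> \<longleftrightarrow> x \<in> convex hull (p ` L ` vertices \<sigma>)" for \<sigma>
  define h where "h \<tau> \<longleftrightarrow> x \<in> convex hull (insert y (p ` L ` vertices \<tau>))" for \<tau>
  have finDE: "finite D" "finite E" using finT by (simp_all add: D_def E_def)
  have label: "L ` vertices \<sigma> \<subseteq> {1..n}" if "\<sigma> \<in> T" for \<sigma>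
  proof -
    have "{v} \<in> T" if "v \<in> vertices \<sigma>" for v
      using T \<open>\<sigma> \<in> T\<close> that face_of_singleton unfolding vertices_def simplicial_complex_def by blast
    then show ?thesis using assms(4) by (auto simp: vertex_set_def Pi_iff)
  qed
  \<comment> \<open>Distinctness of labels is automatic once \<open>x\<close> is in the hull: a
    repeated label would leave at most \<open>CARD('d)\<close> labels, against
    \<open>gen\<close>.\<close>
  have counted: "{\<sigma> \<in> T. int ?d simplex \<sigma> \<and> inj_on L (vertices \<sigma>) \<and>
      convex hull (p ` L ` vertices \<sigma>) \<in> cov (p ` {1..n}) x} = {\<sigma> \<in> D. g \<sigma>}"
  proof -
    have "inj_on L (vertices \<sigma>) \<and> convex hull (p ` L ` vertices \<sigma>) \<in> cov (p ` {1..n}) x"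
      if \<sigma>: "\<sigma> \<in> D" "g \<sigma>" for \<sigma>
    proof -
      let ?C = "vertices \<sigma>"
      have C: "card ?C = ?d + 1" "L ` ?C \<subseteq> {1..n}"
        using \<sigma> simplex_vertices(2)[of "int ?d" \<sigma>] label by (auto simp: D_def)
      then have fin: "finite ?C" using card.infinite by fastforce
      have "\<not> card (L ` ?C) \<le> ?d" using gen[OF C(2)] \<sigma>(2) by (auto simp: g_def)
      then have "inj_on L ?C" using C(1) card_image_le[OF fin, of L] by (intro eq_card_imp_inj_on fin) simp
      moreover have "card (p ` L ` ?C) \<le> ?d + 1"
        using C(1) fin by (metis card_image_le finite_imageI le_trans)
      moreover have "p ` L ` ?C \<noteq> {}" using C(1) by auto
      then have "1 \<le> card (p ` L ` ?C)" using fin by (simp add: Suc_le_eq card_gt_0_iff)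
      ultimately show ?thesis using C(2) \<sigma>(2) unfolding cov_def spanned_simplices_def g_def by blast
    qed
    then show ?thesis by (auto simp: D_def g_def cov_def)
  qed
  \<comment> \<open>The cone parity for \<open>p \<circ> L\<close> on the vertices of \<sigma>, with
    deleted vertices replaced by facets.\<close>
  have local: "even (of_bool (g \<sigma>) + card {\<tau> \<in> {\<tau> \<in> E. h \<tau>}. \<tau> \<subseteq> \<sigma>})" if \<sigma>: "\<sigma> \<in> D" for \<sigma>
  proof -
    let ?C = "vertices \<sigma>"
    have \<sigma>T: "\<sigma> \<in> T" "int ?d simplex \<sigma>" using \<sigma> by (auto simp: D_def)
    note C = simplex_vertices[OF \<sigma>T(2)]
    have fin: "finite ?C" using C(1) aff_independent_finite by blast
    have sub: "L ` J \<subseteq> {1..n}" "card (L ` J) \<le> card J" if "J \<subseteq> ?C" for J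
      using label[OF \<sigma>T(1)] that fin card_image_le finite_subset by (blast, metis)
    have "even (of_bool (x \<in> convex hull ((p \<circ> L) ` ?C)) +
        card {v \<in> ?C. x \<in> convex hull (insert y ((p \<circ> L) ` (?C - {v})))})"
    proof (rule even_card_simplices_containing_cone[OF fin])
      show "card ?C = DIM(real^'d) + 1" using C(2) by simp
      show "x \<notin> convex hull ((p \<circ> L) ` J)" if "J \<subseteq> ?C" "card J \<le> DIM(real^'d)" for J
        using gen[of "L ` J"] sub[OF that(1)] that(2) by (simp add: image_comp)
      show "x \<notin> convex hull (insert y ((p \<circ> L) ` J))" if "J \<subseteq> ?C" "card J < DIM(real^'d)" for J
        using gen_y[of "L ` J"] sub[OF that(1)] that(2) by (simp add: image_comp)
    qed
    moreover have "x \<in> convex hull ((p \<circ> L) ` ?C) \<longleftrightarrow> g \<sigma>" by (simp add: g_def image_comp)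
    moreover have "card {v \<in> ?C. x \<in> convex hull (insert y ((p \<circ> L) ` (?C - {v})))} =
        card {\<tau> \<in> {\<tau> \<in> E. h \<tau>}. \<tau> \<subseteq> \<sigma>}"
    proof -
      let ?f = "\<lambda>v. convex hull (?C - {v})"
      have bij: "bij_betw ?f ?C {\<tau> \<in> T. (int ?d - 1) simplex \<tau> \<and> \<tau> \<subseteq> \<sigma>}"
        by (rule bij_betw_facets[OF T \<sigma>T])
      have hf: "h (?f v) \<longleftrightarrow> x \<in> convex hull (insert y ((p \<circ> L) ` (?C - {v})))" for v
        using vertices_convex_hull[OF affine_independent_Diff[OF C(1), of "{v}"]] by (simp add: h_def image_comp)
      have "bij_betw ?f {v \<in> ?C. h (?f v)} {\<tau> \<in> {\<tau> \<in> E. h \<tau>}. \<tau> \<subseteq> \<sigma>}"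
      proof (rule bij_betw_subset[OF bij])
        show "?f ` {v \<in> ?C. h (?f v)} = {\<tau> \<in> {\<tau> \<in> E. h \<tau>}. \<tau> \<subseteq> \<sigma>}"
        proof -
          have "{\<tau> \<in> {\<tau> \<in> E. h \<tau>}. \<tau> \<subseteq> \<sigma>} = {\<tau> \<in> ?f ` ?C. h \<tau>}"
            unfolding bij_betw_imp_surj_on[OF bij] E_def by blast
          then show ?thesis by (simp only:) blast
        qed
      qed blast
      then show ?thesis unfolding hf by (rule bij_betw_same_card)
    qed
    ultimately show ?thesis by simp
  qed
  have D_alt: "D = {\<sigma> \<in> T. aff_dim \<sigma> = DIM(real^'d)}"
  proof -
    have "int ?d simplex \<sigma> \<longleftrightarrow> aff_dim \<sigma> = int ?d" if \<sigma>: "\<sigma> \<in> T" for \<sigma>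
    proof -
      obtain m where m: "m simplex \<sigma>" using T \<sigma> unfolding simplicial_complex_def by blast
      then show ?thesis using aff_dim_simplex[OF m] aff_dim_simplex[of "int ?d" \<sigma>] by auto
    qed
    then show ?thesis unfolding D_def by auto
  qed
  have two: "card {\<sigma> \<in> D. \<tau> \<subseteq> \<sigma>} = 2" if "\<tau> \<in> E" for \<tau>
  proof -
    have "card {\<sigma> \<in> T. aff_dim \<sigma> = DIM(real^'d) \<and> \<tau> \<subseteq> \<sigma>} = 2"
      using that aff_dim_simplex[of "int ?d - 1" \<tau>]
      by (intro card_cofaces_eq_2[OF T loc]) (simp_all add: E_def)
    moreover have "{\<sigma> \<in> D. \<tau> \<subseteq> \<sigma>} = {\<sigma> \<in> T. aff_dim \<sigma> = DIM(real^'d) \<and> \<tau> \<subseteq> \<sigma>}"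
      unfolding D_alt by blast
    ultimately show ?thesis by simp
  qed
  have "even (\<Sum>\<sigma>\<in>D. of_bool (g \<sigma>) + card {\<tau> \<in> {\<tau> \<in> E. h \<tau>}. \<tau> \<subseteq> \<sigma>})"
    by (rule dvd_sum) (rule local)
  \<comment> \<open>Incidences are summed over facets instead: each lies in exactly two members of
    \<open>D\<close>, so their total is even.\<close>
  moreover have "(\<Sum>\<sigma>\<in>D. card {\<tau> \<in> {\<tau> \<in> E. h \<tau>}. \<tau> \<subseteq> \<sigma>}) = (\<Sum>\<tau>\<in>{\<tau> \<in> E. h \<tau>}. 2)"
    by (rule sum_multicount_gen) (use finDE two in auto)
  moreover have "(\<Sum>\<sigma>\<in>D. of_bool (g \<sigma>)) = card {\<sigma> \<in> D. g \<sigma>}"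
    using finDE by (simp add: sum_of_bool_eq Collect_conj_eq)
  ultimately have "even (card {\<sigma> \<in> D. g \<sigma>} + 2 * card {\<tau> \<in> E. h \<tau>})"
    by (simp add: sum.distrib)
  then show ?thesis unfolding counted by simp
qed

end
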